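(* Let $(M,F)$ be an $n$-dimensional $C^0$-Finsler manifold and suppose that $F$ is locally represented in a coordinate system $\tau_\phi$ as a horizontally $C^1$ family of asymmetric norms, that is, for each $p\in M$ there exist a neighborhood $U$ of $p$, a coordinate system $\phi:U\to\mathbb R^n$ and a local trivialization $\tau:TU\to U\times\mathbb R^n$ such that, with $\tau_\phi=(\phi\times\mathrm{id})\circ\tau$, the function $F\circ(\tau_\phi)^{-1}:\phi(U)\times\mathbb R^n\to\mathbb R$ is a horizontally $C^1$ family of asymmetric norms. Then $F$ is of Pontryagin type.
   Context: An asymmetric norm on a finite dimensional real vector space $V$ is a function $F:V\to[0,\infty)$ with $F(y)=0$ iff $y=0$, $F(\lambda y)=\lambda F(y)$ for $\lambda>0$, and $F(y_1+y_2)\le F(y_1)+F(y_2)$. A $C^0$-Finsler structure on a $C^\infty$ manifold $M$ is a continuous $F:TM\to[0,\infty)$ such that each $F(x,\cdot):T_xM\to[0,\infty)$ is an asymmetric norm; $(M,F)$ is then a $C^0$-Finsler manifold, and $S_F[x,0,1]=\{y\in T_xM:F(x,y)=1\}$. Local trivializations are smooth vector bundle trivializations (fiberwise linear). For $W\subset\mathbb R^n$ open, a continuous $F:W\times\mathbb R^n\to\mathbb R$ is a horizontally $C^1$ family of asymmetric norms if every $F(x,\cdot)$ is an asymmetric norm and $(x,y)\mapsto\frac{\partial F}{\partial x^i}(x,y)$ is continuous on $W\times\mathbb R^n$ for $i=1,\dots,n$. $(M,F)$ is of Pontryagin type at $p\in M$ if there are a neighborhood $U$ of $p$, a coordinate system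 $(x^1,\dots,x^n):U\to\mathbb R^n$ (with natural coordinates $(x^1,\dots,x^n,y^1,\dots,y^n)$ on $TU$) and a family of $C^1$ unit vector fields $X_u(x)=(y^1(x,u),\dots,y^n(x,u))$ on $U$ (i.e. $F(x,X_u(x))=1$), parameterized by $u\in S^{n-1}\subset\mathbb R^n$ (Euclidean unit sphere), such that (1) for every $x\in U$, $u\mapsto X_u(x)$ is a homeomorphism of $S^{n-1}$ onto $S_F[x,0,1]$; (2) $(x,u)\mapsto(y^1(x,u),\dots,y^n(x,u))$ is continuous; (3) $(x,u)\mapsto(\frac{\partial y^1}{\partial x^i}(x,u),\dots,\frac{\partial y^n}{\partial x^i}(x,u))$ is continuous for every $i=1,\dots,n$. $F$ is of Pontryagin type if it is so at every $p\in M$. *)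

theory Defs
  imports "HOL-Analysis.Analysis" "HOL-Library.Function_Algebras"
begin

section \<open>Pointwise real vector space of functions\<close>

instantiation "fun" :: (type, real_vector) real_vector
begin

definition scaleR_fun :: "real \<Rightarrow> ('a \<Rightarrow> 'b) \<Rightarrow> 'a \<Rightarrow> 'b"
  where "scaleR_fun r f = (\<lambda>x. r *\<^sub>R f x)"

instance
  by standard (simp_all add: scaleR_fun_def fun_eq_iff scaleR_add_right scaleR_add_left)

end

section \<open>Differentiability classes between normed spaces\<close>

text \<open>The set \<^term>\<open>S\<close> is always meant to be open.\<close>

primrec Ck_on ::
  "nat \<Rightarrow> 'e::real_normed_vector set \<Rightarrow> ('e \<Rightarrow> 'f::real_normed_vector) \<Rightarrow> bool"
where
  "Ck_on 0 S f \<longleftrightarrow> continuous_on S f"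
| "Ck_on (Suc k) S f \<longleftrightarrow>
     (\<forall>x\<in>S. f differentiable (at x)) \<and>
     (\<forall>v. Ck_on k S (\<lambda>x. frechet_derivative f (at x) v))"

definition smooth_on ::
  "'e::real_normed_vector set \<Rightarrow> ('e \<Rightarrow> 'f::real_normed_vector) \<Rightarrow> bool"
  where "smooth_on S f \<longleftrightarrow> (\<forall>k. Ck_on k S f)"

definition has_partial_derivative ::
  "(real^'n \<Rightarrow> 'f::real_normed_vector) \<Rightarrow> 'n \<Rightarrow> 'f \<Rightarrow> real^'n \<Rightarrow> bool"
  where "has_partial_derivative f i d x \<longleftrightarrow>
    ((\<lambda>t. f (x + t *\<^sub>R axis i 1)) has_vector_derivative d) (at 0)"

section \<open>Smooth manifolds\<close>

text \<open>
  A chart is a pair of its domain and its coordinate map. The values of the coordinate map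
  outside the domain are irrelevant, and every notion below ignores them; in particular a
  maximal atlas contains all variants of a chart that differ only outside the domain.
\<close>

type_synonym ('a, 'e) chart = "'a set \<times> ('a \<Rightarrow> 'e)"

definition chart_of :: "'a topology \<Rightarrow> ('a, 'e::euclidean_space) chart \<Rightarrow> bool"
  where "chart_of M c \<longleftrightarrow>
    openin M (fst c) \<and> open (snd c ` fst c) \<and>
    homeomorphic_map (subtopology M (fst c)) (top_of_set (snd c ` fst c)) (snd c)"

definition transition :: "('a, 'e) chart \<Rightarrow> ('a, 'e) chart \<Rightarrow> 'e \<Rightarrow> 'e"
  where "transition c d = snd d \<circ> inv_into (fst c) (snd c)"

definition compatible :: "('a, 'e::euclidean_space) chart \<Rightarrow> ('a, 'e) chart \<Rightarrow> bool"
  where "compatible c d \<longleftrightarrow>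
    smooth_on (snd c ` (fst c \<inter> fst d)) (transition c d) \<and>
    smooth_on (snd d ` (fst c \<inter> fst d)) (transition d c)"

definition smooth_manifold :: "'a topology \<Rightarrow> ('a, 'e::euclidean_space) chart set \<Rightarrow> bool"
  where "smooth_manifold M A \<longleftrightarrow>
    Hausdorff_space M \<and> second_countable M \<and>
    (\<forall>c\<in>A. chart_of M c) \<and>
    (\<Union>c\<in>A. fst c) = topspace M \<and>
    (\<forall>c\<in>A. \<forall>d\<in>A. compatible c d) \<and>
    (\<forall>c. chart_of M c \<and> (\<forall>d\<in>A. compatible c d) \<longrightarrow> c \<in> A)"

text \<open>
  Smooth maps and diffeomorphisms between open sets \<^term>\<open>S\<close> and \<^term>\<open>T\<close> of manifolds with
  (not necessarily maximal) atlases \<^term>\<open>A\<close> and \<^term>\<open>B\<close>. Openness of the domains of the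
  coordinate representations expresses that \<^term>\<open>S\<close> is open and \<^term>\<open>f\<close> is continuous.
\<close>

definition smooth_map ::
  "('a, 'e::euclidean_space) chart set \<Rightarrow> 'a set \<Rightarrow>
   ('b, 'f::euclidean_space) chart set \<Rightarrow> ('a \<Rightarrow> 'b) \<Rightarrow> bool"
  where "smooth_map A S B f \<longleftrightarrow>
    (\<forall>c\<in>A. \<forall>d\<in>B.
      open (snd c ` {x \<in> S \<inter> fst c. f x \<in> fst d}) \<and>
      smooth_on (snd c ` {x \<in> S \<inter> fst c. f x \<in> fst d})
        (snd d \<circ> f \<circ> inv_into (fst c) (snd c)))"

definition diffeomorphism ::
  "('a, 'e::euclidean_space) chart set \<Rightarrow> 'a set \<Rightarrow>
   ('b, 'f::euclidean_space) chart set \<Rightarrow> 'b set \<Rightarrow> ('a \<Rightarrow> 'b) \<Rightarrow> bool"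
  where "diffeomorphism A S B T f \<longleftrightarrow>
    bij_betw f S T \<and> smooth_map A S B f \<and> smooth_map B T A (inv_into S f)"

section \<open>The tangent bundle\<close>

text \<open>
  A tangent vector at \<^term>\<open>p\<close> is the family of its coordinate vectors in all charts around
  \<^term>\<open>p\<close>, transforming by the derivatives of the transition maps; equivalently, the graph of an
  equivalence class of pairs (chart, coordinate vector). The value at any other index is set to
  zero, so that equality of functions is equality of tangent vectors and the vector space
  structure is the pointwise one.
\<close>

type_synonym ('a, 'e) tangent_vector = "('a, 'e) chart \<Rightarrow> 'e"

definition tangent_space ::
  "('a, 'e::euclidean_space) chart set \<Rightarrow> 'a \<Rightarrow> ('a, 'e) tangent_vector set"
  where "tangent_space A p =
    {v. (\<forall>c. c \<notin> A \<or> p \<notin> fst c \<longrightarrow> v c = 0) \<and>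
        (\<forall>c\<in>A. \<forall>d\<in>A. p \<in> fst c \<and> p \<in> fst d \<longrightarrow>
           v d = frechet_derivative (transition c d) (at (snd c p)) (v c))}"

definition tangent_bundle ::
  "('a, 'e::euclidean_space) chart set \<Rightarrow> 'a set \<Rightarrow> ('a \<times> ('a, 'e) tangent_vector) set"
  where "tangent_bundle A U = Sigma U (tangent_space A)"

text \<open>The natural coordinates \<open>(x, y)\<close> of the tangent bundle induced by a chart.\<close>

definition tangent_chart ::
  "('a, 'e::euclidean_space) chart set \<Rightarrow> ('a, 'e) chart \<Rightarrow>
   ('a \<times> ('a, 'e) tangent_vector, 'e \<times> 'e) chart"
  where "tangent_chart A c = (tangent_bundle A (fst c), (\<lambda>(p, v). (snd c p, v c)))"

definition tangent_atlas ::
  "('a, 'e::euclidean_space) chart set \<Rightarrow>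
   ('a \<times> ('a, 'e) tangent_vector, 'e \<times> 'e) chart set"
  where "tangent_atlas A = tangent_chart A ` A"

definition tangent_topology ::
  "('a, 'e::euclidean_space) chart set \<Rightarrow> ('a \<times> ('a, 'e) tangent_vector) topology"
  where "tangent_topology A = topology_generated_by
    {{z \<in> fst c. snd c z \<in> W} | c W. c \<in> tangent_atlas A \<and> open W}"

definition product_atlas ::
  "('a, 'e::euclidean_space) chart set \<Rightarrow> ('a \<times> 'f::euclidean_space, 'e \<times> 'f) chart set"
  where "product_atlas A = (\<lambda>c. (fst c \<times> UNIV, map_prod (snd c) id)) ` A"

definition local_trivialization ::
  "('a, 'e::euclidean_space) chart set \<Rightarrow> 'a set \<Rightarrow>
   ('a \<times> ('a, 'e) tangent_vector \<Rightarrow> 'a \<times> 'e) \<Rightarrow> bool"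
  where "local_trivialization A U \<tau> \<longleftrightarrow>
    diffeomorphism (tangent_atlas A) (tangent_bundle A U) (product_atlas A) (U \<times> UNIV) \<tau> \<and>
    (\<forall>p\<in>U. \<forall>v\<in>tangent_space A p. fst (\<tau> (p, v)) = p) \<and>
    (\<forall>p\<in>U. \<forall>v\<in>tangent_space A p. \<forall>w\<in>tangent_space A p.
       snd (\<tau> (p, v + w)) = snd (\<tau> (p, v)) + snd (\<tau> (p, w))) \<and>
    (\<forall>p\<in>U. \<forall>v\<in>tangent_space A p. \<forall>r. snd (\<tau> (p, r *\<^sub>R v)) = r *\<^sub>R snd (\<tau> (p, v)))"

section \<open>Asymmetric norms and Finsler structures\<close>

definition asymmetric_norm_on :: "'v::real_vector set \<Rightarrow> ('v \<Rightarrow> real) \<Rightarrow> bool"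
  where "asymmetric_norm_on V N \<longleftrightarrow>
    (\<forall>y\<in>V. 0 \<le> N y) \<and>
    (\<forall>y\<in>V. N y = 0 \<longleftrightarrow> y = 0) \<and>
    (\<forall>y\<in>V. \<forall>r>0. N (r *\<^sub>R y) = r * N y) \<and>
    (\<forall>y\<in>V. \<forall>z\<in>V. N (y + z) \<le> N y + N z)"

definition C0_Finsler ::
  "'a topology \<Rightarrow> ('a, 'e::euclidean_space) chart set \<Rightarrow>
   ('a \<times> ('a, 'e) tangent_vector \<Rightarrow> real) \<Rightarrow> bool"
  where "C0_Finsler M A F \<longleftrightarrow>
    continuous_map (tangent_topology A) euclideanreal F \<and>
    (\<forall>p\<in>topspace M. asymmetric_norm_on (tangent_space A p) (\<lambda>v. F (p, v)))"

text \<open>The unit sphere in the tangent space at \<^term>\<open>p\<close>, as a subset of the tangent bundle.\<close>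

definition unit_sphere ::
  "('a, 'e::euclidean_space) chart set \<Rightarrow> ('a \<times> ('a, 'e) tangent_vector \<Rightarrow> real) \<Rightarrow>
   'a \<Rightarrow> ('a \<times> ('a, 'e) tangent_vector) set"
  where "unit_sphere A F p = {(p, v) | v. v \<in> tangent_space A p \<and> F (p, v) = 1}"

definition horizontally_C1 ::
  "(real^'n) set \<Rightarrow> ((real^'n) \<times> (real^'n) \<Rightarrow> real) \<Rightarrow> bool"
  where "horizontally_C1 W G \<longleftrightarrow>
    open W \<and>
    continuous_on (W \<times> UNIV) G \<and>
    (\<forall>x\<in>W. asymmetric_norm_on UNIV (\<lambda>y. G (x, y))) \<and>
    (\<forall>i. \<exists>D. continuous_on (W \<times> UNIV) D \<and>
       (\<forall>x\<in>W. \<forall>y. has_partial_derivative (\<lambda>x'. G (x', y)) i (D (x, y)) x))"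

text \<open>
  \<^term>\<open>X u q\<close> is the value at the point \<^term>\<open>q\<close> of the vector field with index \<^term>\<open>u\<close>, and
  \<^term>\<open>Y (x, u)\<close> is its coordinate vector \<open>(y\<^sup>1(x,u), \<dots>, y\<^sup>n(x,u))\<close>, where points of
  \<^term>\<open>U\<close> are identified with their coordinates \<^term>\<open>x\<close>.
\<close>

definition Pontryagin_type_at ::
  "('a, real^'n) chart set \<Rightarrow> ('a \<times> ('a, real^'n) tangent_vector \<Rightarrow> real) \<Rightarrow> 'a \<Rightarrow> bool"
  where "Pontryagin_type_at A F p \<longleftrightarrow>
    (\<exists>U \<phi> (X :: real^'n \<Rightarrow> 'a \<Rightarrow> ('a, real^'n) tangent_vector).
      (U, \<phi>) \<in> A \<and> p \<in> U \<and>
      (let Y = (\<lambda>(x, u). X u (inv_into U \<phi> x) (U, \<phi>)) in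
        (\<forall>u\<in>sphere 0 1.
           (\<forall>q\<in>U. X u q \<in> tangent_space A q \<and> F (q, X u q) = 1) \<and>
           Ck_on 1 (\<phi> ` U) (\<lambda>x. Y (x, u))) \<and>
        (\<forall>q\<in>U. homeomorphic_map (top_of_set (sphere 0 1))
           (subtopology (tangent_topology A) (unit_sphere A F q)) (\<lambda>u. (q, X u q))) \<and>
        continuous_on (\<phi> ` U \<times> sphere 0 1) Y \<and>
        (\<forall>i. \<exists>D. continuous_on (\<phi> ` U \<times> sphere 0 1) D \<and>
           (\<forall>x\<in>\<phi> ` U. \<forall>u\<in>sphere 0 1.
              has_partial_derivative (\<lambda>x'. Y (x', u)) i (D (x, u)) x))))"

definition Pontryagin_type ::
  "'a topology \<Rightarrow> ('a, real^'n) chart set \<Rightarrow>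
   ('a \<times> ('a, real^'n) tangent_vector \<Rightarrow> real) \<Rightarrow> bool"
  where "Pontryagin_type M A F \<longleftrightarrow> (\<forall>p\<in>topspace M. Pontryagin_type_at A F p)"

end

theory Submission
  imports Defs
begin

text \<open>
  Let \<open>G\<close> be the representation of \<open>F\<close> in the trivialization. The Euclidean unit sphere is mapped
  onto the unit sphere of \<open>G(x, \<cdot>)\<close> by \<open>u \<mapsto> u / G(x, u)\<close>, and the inverse of the trivialization
  carries these vectors back to the tangent bundle; this defines \<open>X\<^sub>u\<close>. In natural coordinates the
  field is \<open>P(x, u) / G(x, u)\<close>, where \<open>P\<close> is smooth and linear in \<open>u\<close>, so its partial derivatives
  with respect to \<open>x\<close> exist and are jointly continuous by the quotient rule. Continuous partial
  derivatives give \<open>C\<^sup>1\<close>, and compactness of the sphere gives the homeomorphism.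
\<close>

section \<open>Continuous partial derivatives and the class C^1\<close>

lemma has_partial_derivative_line:
  assumes "has_partial_derivative f i d (z + s *\<^sub>R axis i 1)"
  shows "((\<lambda>t. f (z + t *\<^sub>R axis i 1)) has_vector_derivative d) (at s)"
proof -
  have "((\<lambda>t. f (z + s *\<^sub>R axis i 1 + t *\<^sub>R axis i 1)) has_vector_derivative d) (at (s + - s))"
    using assms by (simp add: has_partial_derivative_def)
  moreover have "((\<lambda>t. t + - s) has_vector_derivative 1) (at s)"
    by (auto intro!: derivative_eq_intros)
  ultimately have "((\<lambda>t. f (z + s *\<^sub>R axis i 1 + t *\<^sub>R axis i 1)) \<circ> (\<lambda>t. t + - s)
      has_vector_derivative 1 *\<^sub>R d) (at s)"
    by (rule vector_diff_chain_at[rotated])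
  moreover have "(\<lambda>t. f (z + s *\<^sub>R axis i 1 + t *\<^sub>R axis i 1)) \<circ> (\<lambda>t. t + - s) =
      (\<lambda>t. f (z + t *\<^sub>R axis i 1))"
    by (simp add: fun_eq_iff algebra_simps)
  ultimately show ?thesis by simp
qed

text \<open>Mean value inequality for \<open>f\<close> minus the linear term of slope
  \<open>c\<close> along a coordinate direction. Running the segment over \<open>{0..1}\<close> with
  factor \<open>a\<close> treats both signs of \<open>a\<close> at once.\<close>

lemma partial_increment_bound:
  fixes f :: "real^'n \<Rightarrow> 'f::real_normed_vector"
  assumes der: "\<And>t. t \<in> {0..1} \<Longrightarrow>
      has_partial_derivative f i (D (z + (t * a) *\<^sub>R axis i 1)) (z + (t * a) *\<^sub>R axis i 1)"
    and bound: "\<And>t. t \<in> {0..1} \<Longrightarrow> norm (D (z + (t * a) *\<^sub>R axis i 1) - c) \<le> e"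
  shows "norm (f (z + a *\<^sub>R axis i 1) - f z - a *\<^sub>R c) \<le> e * \<bar>a\<bar>"
proof -
  define psi where "psi t = f (z + (t * a) *\<^sub>R axis i 1) - (t * a) *\<^sub>R c" for t
  define psi' where "psi' t = a *\<^sub>R (D (z + (t * a) *\<^sub>R axis i 1) - c)" for t
  have "(psi has_derivative (\<lambda>h. h *\<^sub>R psi' t)) (at t within {0..1})" if "t \<in> {0..1}" for t
  proof -
    have "((\<lambda>t. t * a) has_vector_derivative a) (at t)"
      by (auto intro!: derivative_eq_intros simp flip: has_real_derivative_iff_has_vector_derivative)
    from vector_diff_chain_at[OF this has_partial_derivative_line[OF der[OF that]]]
    have "((\<lambda>t. f (z + (t * a) *\<^sub>R axis i 1)) has_vector_derivative
        a *\<^sub>R D (z + (t * a) *\<^sub>R axis i 1)) (at t)"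
      by (simp add: o_def)
    moreover have "((\<lambda>t. (t * a) *\<^sub>R c) has_vector_derivative a *\<^sub>R c) (at t)"
      by (auto intro!: derivative_eq_intros)
    ultimately have "(psi has_vector_derivative psi' t) (at t)"
      unfolding psi_def psi'_def scaleR_diff_right by (rule has_vector_derivative_diff)
    then show ?thesis
      unfolding has_vector_derivative_def by (rule has_derivative_at_withinI)
  qed
  moreover have "onorm (\<lambda>h. h *\<^sub>R psi' t) \<le> e * \<bar>a\<bar>" if "t \<in> {0..1}" for t
  proof (rule onorm_le)
    fix h :: real
    have "\<bar>a\<bar> * norm (D (z + (t * a) *\<^sub>R axis i 1) - c) \<le> \<bar>a\<bar> * e"
      using bound[OF that] by (simp add: mult_left_mono)
    from mult_left_mono[OF this abs_ge_zero[of h]]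
    show "norm (h *\<^sub>R psi' t) \<le> e * \<bar>a\<bar> * norm h"
      by (simp add: psi'_def abs_mult mult_ac)
  qed
  ultimately have "norm (psi 1 - psi 0) \<le> e * \<bar>a\<bar> * norm (1 - 0 :: real)"
    by (intro differentiable_bound[of "{0..1}"]) auto
  then show ?thesis
    by (simp add: psi_def algebra_simps)
qed

text \<open>The increment from \<open>x\<close> to \<open>y\<close> is split into steps that change
  one coordinate each. The mean value estimate compares each step with \<open>D i x\<close>, and
  continuity of the \<open>D i\<close> makes the errors small.\<close>

lemma has_derivative_continuous_partials:
  fixes f :: "real^'n \<Rightarrow> 'f::real_normed_vector"
  assumes S: "open S" "x \<in> S"
    and der: "\<And>i y. y \<in> S \<Longrightarrow> has_partial_derivative f i (D i y) y"
    and cont: "\<And>i. continuous_on S (D i)"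
  shows "(f has_derivative (\<lambda>h. \<Sum>i\<in>UNIV. (h $ i) *\<^sub>R D i x)) (at x)"
  unfolding has_derivative_at_alt
proof (intro conjI allI impI)
  show "bounded_linear (\<lambda>h. \<Sum>i\<in>UNIV. (h $ i) *\<^sub>R D i x)"
    by (intro bounded_linear_sum bounded_linear_compose[OF bounded_linear_scaleR_left]
        bounded_linear_vec_nth)
next
  fix e :: real
  assume "0 < e"
  \<comment> \<open>Each of the \<open>CARD('n)\<close> coordinate steps costs at most
    \<open>e' * norm h\<close>, so the total error is at most \<open>e * norm h\<close>.\<close>
  define e' where "e' = e / CARD('n)"
  have "0 < e'" using \<open>0 < e\<close> by (simp add: e'_def)
  have "\<forall>\<^sub>F y in nhds x. norm (D i y - D i x) < e'" for i
  proof -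
    have "(D i \<longlongrightarrow> D i x) (nhds x)"
      using cont[of i] S by (simp add: continuous_on_eq_continuous_at tendsto_at_iff_tendsto_nhds
          continuous_at)
    from tendstoD[OF this \<open>0 < e'\<close>] show ?thesis by (simp add: dist_norm)
  qed
  then have "\<forall>\<^sub>F y in nhds x. y \<in> S \<and> (\<forall>i. norm (D i y - D i x) < e')"
    using S by (intro eventually_conj eventually_all_finite) (auto intro: eventually_nhds_in_open)
  then obtain d where "d > 0" and d: "\<And>y. dist y x < d \<Longrightarrow> y \<in> S \<and> (\<forall>i. norm (D i y - D i x) < e')"
    by (auto simp: eventually_nhds_metric)
  have "norm (f y - f x - (\<Sum>i\<in>UNIV. ((y - x) $ i) *\<^sub>R D i x)) \<le> e * norm (y - x)"
    if y: "norm (y - x) < d" for y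
  proof -
    define h where "h = y - x"
    \<comment> \<open>The points \<open>x + r I\<close> are the intermediate points of the
      splitting: induction on \<open>I\<close> switches on one coordinate at a time, from
      \<open>r {} = 0\<close> to \<open>r UNIV = h\<close>.\<close>
    define r :: "'n set \<Rightarrow> real^'n" where "r I = (\<chi> i. if i \<in> I then h $ i else 0)" for I
    have "norm (f (x + r I) - f x - (\<Sum>i\<in>I. (h $ i) *\<^sub>R D i x)) \<le> (\<Sum>i\<in>I. e' * \<bar>h $ i\<bar>)" for I
      using finite[of I]
    proof (induction I rule: finite_induct)
      case empty
      have "r {} = 0" by (simp add: r_def vec_eq_iff)
      then show ?case by simp
    next
      case (insert j I)
      have r: "r (insert j I) = r I + (h $ j) *\<^sub>R axis j 1"
        using insert.hyps by (auto simp: r_def vec_eq_iff axis_def)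
      \<comment> \<open>No coordinate of the displacement exceeds that of \<open>h\<close> in
        absolute value, so the whole segment stays in the ball around \<open>x\<close>.\<close>
      have near: "dist (x + r I + (t * h $ j) *\<^sub>R axis j 1) x < d" if "t \<in> {0..1}" for t
      proof -
        have "norm (r I + (t * h $ j) *\<^sub>R axis j 1) \<le> norm h"
        proof (rule norm_le_componentwise_cart)
          fix i
          show "norm ((r I + (t * h $ j) *\<^sub>R axis j 1) $ i) \<le> norm (h $ i)"
            using that insert.hyps
            by (auto simp: r_def axis_def abs_mult mult_left_le_one_le)
        qed
        then show ?thesis
          using y by (simp add: dist_norm h_def add.assoc)
      qed
      have "norm (f (x + r I + (h $ j) *\<^sub>R axis j 1) - f (x + r I) - (h $ j) *\<^sub>R D j x) \<le> e' * \<bar>h $ j\<bar>"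
        using d[OF near] by (intro partial_increment_bound[where D = "D j"] der) (auto intro: less_imp_le)
      from norm_triangle_le[OF add_mono[OF this insert.IH]]
      show ?case
        using insert.hyps by (simp add: r algebra_simps)
    qed
    from this[of UNIV] have "norm (f (x + h) - f x - (\<Sum>i\<in>UNIV. (h $ i) *\<^sub>R D i x)) \<le>
        (\<Sum>i\<in>UNIV. e' * \<bar>h $ i\<bar>)"
      by (simp add: r_def)
    also have "\<dots> \<le> (\<Sum>i\<in>(UNIV::'n set). e' * norm h)"
      using \<open>0 < e'\<close> by (intro sum_mono mult_left_mono component_le_norm_cart) auto
    also have "\<dots> = e * norm h" by (simp add: e'_def)
    finally show ?thesis by (simp add: h_def)
  qed
  with \<open>d > 0\<close> show "\<exists>d>0. \<forall>y. norm (y - x) < d \<longrightarrow>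
      norm (f y - f x - (\<Sum>i\<in>UNIV. ((y - x) $ i) *\<^sub>R D i x)) \<le> e * norm (y - x)"
    by blast
qed

text \<open>For a fixed vector \<open>v\<close>, the derivative applied to \<open>v\<close> is a
  combination of the partial derivatives with constant coefficients, hence continuous in the base
  point.\<close>

lemma Ck_on_1_continuous_partials:
  fixes f :: "real^'n \<Rightarrow> 'f::real_normed_vector"
  assumes "open S"
    and "\<And>i y. y \<in> S \<Longrightarrow> has_partial_derivative f i (D i y) y"
    and "\<And>i. continuous_on S (D i)"
  shows "Ck_on 1 S f"
proof -
  note der = has_derivative_continuous_partials[OF assms(1) _ assms(2,3)]
  have "continuous_on S (\<lambda>x. frechet_derivative f (at x) v)" for v
  proof (rule continuous_on_eq)
    show "continuous_on S (\<lambda>x. \<Sum>i\<in>UNIV. (v $ i) *\<^sub>R D i x)"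
      by (intro continuous_intros assms)
    show "(\<Sum>i\<in>UNIV. (v $ i) *\<^sub>R D i x) = frechet_derivative f (at x) v" if "x \<in> S" for x
      using frechet_derivative_at[OF der[OF that]] by (simp add: fun_eq_iff)
  qed
  then show ?thesis
    using der by (auto simp: differentiable_def)
qed

section \<open>Rules for partial derivatives\<close>

lemma has_partial_derivative_cong_open:
  assumes "has_partial_derivative f i d x" "open S" "x \<in> S" "\<And>y. y \<in> S \<Longrightarrow> f y = g y"
  shows "has_partial_derivative g i d x"
proof -
  have "isCont (\<lambda>t. x + t *\<^sub>R axis i 1) t" for t
    by (intro continuous_intros)
  then have "open ((\<lambda>t. x + t *\<^sub>R axis i 1) -` S)"
    using assms(2) by (simp add: continuous_at_imp_continuous_on continuous_open_vimage)
  with assms(1) show ?thesis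
    unfolding has_partial_derivative_def
    by (rule has_vector_derivative_transform_within_open) (use assms(3,4) in auto)
qed

lemma has_partial_derivative_scaleR:
  assumes "has_partial_derivative f i f' x" "has_partial_derivative g i g' x"
  shows "has_partial_derivative (\<lambda>x. f x *\<^sub>R g x) i (f x *\<^sub>R g' + f' *\<^sub>R g x) x"
  using has_vector_derivative_scaleR[OF assms(1)[unfolded has_partial_derivative_def,
        folded has_real_derivative_iff_has_vector_derivative]
      assms(2)[unfolded has_partial_derivative_def]]
  by (simp add: has_partial_derivative_def)

lemma has_partial_derivative_inverse:
  fixes f :: "real^'n \<Rightarrow> real"
  assumes "has_partial_derivative f i f' x" "f x \<noteq> 0"
  shows "has_partial_derivative (\<lambda>x. inverse (f x)) i (- (inverse (f x) * f' * inverse (f x))) x"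
  using DERIV_inverse'[OF assms(1)[unfolded has_partial_derivative_def,
        folded has_real_derivative_iff_has_vector_derivative]] assms(2)
  by (simp add: has_partial_derivative_def flip: has_real_derivative_iff_has_vector_derivative)

text \<open>Extracts a horizontal partial derivative from joint differentiability: the chain rule
  along the line that moves \<open>x\<close> and freezes \<open>y\<close>.\<close>

lemma has_partial_derivative_Pair:
  assumes "(f has_derivative f') (at (x, y))"
  shows "has_partial_derivative (\<lambda>x. f (x, y)) i (f' (axis i 1, 0)) x"
proof -
  have "((\<lambda>t. (x + t *\<^sub>R axis i 1, y)) has_derivative (\<lambda>t. (t *\<^sub>R axis i 1, 0))) (at 0)"
    by (auto intro!: derivative_eq_intros)
  moreover have "(f has_derivative f') (at (x + 0 *\<^sub>R axis i 1, y))" using assms by simp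
  ultimately have "((\<lambda>t. f (x + t *\<^sub>R axis i 1, y)) has_derivative (\<lambda>t. f' (t *\<^sub>R axis i 1, 0))) (at 0)"
    by (rule has_derivative_compose)
  moreover have "f' (t *\<^sub>R axis i 1, 0) = t *\<^sub>R f' (axis i 1, 0)" for t
    using linear_scale[OF has_derivative_linear[OF assms], of t "(axis i 1, 0)"] by simp
  ultimately show ?thesis
    by (simp add: has_partial_derivative_def has_vector_derivative_def)
qed

section \<open>Tangent spaces and the topology of the tangent bundle\<close>

lemma smooth_manifold_chart:
  assumes "smooth_manifold M A" "c \<in> A"
  shows "fst c \<subseteq> topspace M" "inj_on (snd c) (fst c)"
proof -
  have c: "chart_of M c"
    using assms unfolding smooth_manifold_def by blast
  then show sub: "fst c \<subseteq> topspace M"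
    by (simp add: chart_of_def openin_subset)
  from c have "inj_on (snd c) (topspace (subtopology M (fst c)))"
    unfolding chart_of_def by (blast dest: homeomorphic_imp_injective_map)
  with sub show "inj_on (snd c) (fst c)"
    by (simp add: Int_absorb1)
qed

lemma transition_differentiable:
  assumes "smooth_manifold M A" "c \<in> A" "d \<in> A" "p \<in> fst c" "p \<in> fst d"
  shows "transition c d differentiable (at (snd c p))"
proof -
  have "Ck_on 1 (snd c ` (fst c \<inter> fst d)) (transition c d)"
    using assms(1-3) unfolding smooth_manifold_def compatible_def smooth_on_def by blast
  then show ?thesis
    using assms(4,5) by auto
qed

lemma tangent_space_transform:
  assumes "v \<in> tangent_space A p" "c \<in> A" "d \<in> A" "p \<in> fst c" "p \<in> fst d"
  shows "v d = frechet_derivative (transition c d) (at (snd c p)) (v c)"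
  using assms unfolding tangent_space_def by blast

text \<open>Scaling commutes with the transformation law because the transition maps are
  differentiable, which makes their \<open>frechet_derivative\<close> linear.\<close>

lemma tangent_space_scaleR:
  assumes "smooth_manifold M A" "v \<in> tangent_space A p"
  shows "r *\<^sub>R v \<in> tangent_space A p"
proof -
  have "r *\<^sub>R v d = frechet_derivative (transition c d) (at (snd c p)) (r *\<^sub>R v c)"
    if "c \<in> A" "d \<in> A" "p \<in> fst c" "p \<in> fst d" for c d
    using linear_scale[OF linear_frechet_derivative[OF transition_differentiable[OF assms(1) that]]]
      tangent_space_transform[OF assms(2) that] by metis
  moreover have "r *\<^sub>R v c = 0" if "c \<notin> A \<or> p \<notin> fst c" for c
  proof -
    have "v c = 0"
      using assms(2) that unfolding tangent_space_def by blast
    then show ?thesis by simp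
  qed
  ultimately show ?thesis
    unfolding tangent_space_def scaleR_fun_def by blast
qed

text \<open>The transformation law determines the coordinates in every other chart around the point,
  and the default value zero settles all remaining indices.\<close>

lemma tangent_space_eqI:
  assumes "v \<in> tangent_space A p" "w \<in> tangent_space A p" "c \<in> A" "p \<in> fst c" "v c = w c"
  shows "v = w"
proof
  fix d
  show "v d = w d"
  proof (cases "d \<in> A \<and> p \<in> fst d")
    case True
    then show ?thesis
      using assms(5) tangent_space_transform[OF assms(1,3) _ assms(4)]
        tangent_space_transform[OF assms(2,3) _ assms(4)] by metis
  next
    case False
    then have "v d = 0" "w d = 0"
      using assms(1,2) unfolding tangent_space_def by blast+
    then show ?thesis by simp
  qed
qed

lemma topspace_tangent_topology:
  assumes "smooth_manifold M A"
  shows "topspace (tangent_topology A) = tangent_bundle A (topspace M)"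
proof -
  have "(\<Union>c\<in>A. fst c) = topspace M"
    using assms unfolding smooth_manifold_def by blast
  then have "tangent_bundle A (topspace M) = (\<Union>c\<in>A. tangent_bundle A (fst c))"
    unfolding tangent_bundle_def by blast
  moreover have "topspace (tangent_topology A) = (\<Union>c\<in>tangent_atlas A. fst c)"
    unfolding tangent_topology_def topology_generated_by_topspace by blast
  ultimately show ?thesis
    by (simp add: tangent_atlas_def tangent_chart_def)
qed

text \<open>
  On a single tangent space the tangent topology is determined by the coordinates in one chart,
  since the coordinates in any other chart depend linearly on them.
\<close>

lemma continuous_map_into_tangent_space:
  assumes M: "smooth_manifold M A" and c: "c \<in> A" "q \<in> fst c"
    and X: "\<And>u. u \<in> S \<Longrightarrow> X u \<in> tangent_space A q"
    and cont: "continuous_on S (\<lambda>u. X u c)"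
  shows "continuous_map (top_of_set S) (tangent_topology A) (\<lambda>u. (q, X u))"
  unfolding tangent_topology_def
proof (rule continuous_on_generated_topo)
  fix Z
  assume "Z \<in> {{z \<in> fst c. snd c z \<in> W} |c W. c \<in> tangent_atlas A \<and> open W}"
  then obtain c' W where "c' \<in> tangent_atlas A" and W: "open W"
    and Z: "Z = {z \<in> fst c'. snd c' z \<in> W}"
    by blast
  then obtain d where d: "d \<in> A" and "c' = tangent_chart A d"
    by (auto simp: tangent_atlas_def)
  with Z have Z: "Z = {z \<in> tangent_bundle A (fst d). (snd d (fst z), snd z d) \<in> W}"
    by (simp add: tangent_chart_def case_prod_beta)
  show "openin (top_of_set S) ((\<lambda>u. (q, X u)) -` Z \<inter> topspace (top_of_set S))"
  proof (cases "q \<in> fst d")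
    case True
    have "continuous_on UNIV (frechet_derivative (transition c d) (at (snd c q)))"
      using linear_frechet_derivative[OF transition_differentiable[OF M c(1) d c(2) True]]
      by (simp add: linear_continuous_on linear_conv_bounded_linear)
    from continuous_on_compose2[OF this cont]
    have "continuous_on S (\<lambda>u. frechet_derivative (transition c d) (at (snd c q)) (X u c))"
      by simp
    then have "continuous_on S (\<lambda>u. X u d)"
    proof (rule continuous_on_eq)
      show "frechet_derivative (transition c d) (at (snd c q)) (X u c) = X u d" if "u \<in> S" for u
        using tangent_space_transform[OF X[OF that] c(1) d c(2) True] by simp
    qed
    then have "continuous_on S (\<lambda>u. (snd d q, X u d))"
      by (intro continuous_intros)
    then have "openin (top_of_set S) (S \<inter> (\<lambda>u. (snd d q, X u d)) -` W)"
      using W by (rule continuous_openin_preimage_gen)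
    moreover have "S \<inter> (\<lambda>u. (snd d q, X u d)) -` W = (\<lambda>u. (q, X u)) -` Z \<inter> S"
      using X True by (auto simp: Z tangent_bundle_def)
    ultimately show ?thesis by simp
  next
    \<comment> \<open>Here the basic open set does not meet the fibre over \<open>q\<close>, so the
      preimage is empty.\<close>
    case False
    then show ?thesis by (simp add: Z tangent_bundle_def vimage_def)
  qed
next
  have "(q, X u) \<in> tangent_bundle A (topspace M)" if "u \<in> S" for u
    using c X[OF that] smooth_manifold_chart(1)[OF M c(1)] by (auto simp: tangent_bundle_def)
  then show "(\<lambda>u. (q, X u)) ` topspace (top_of_set S) \<subseteq>
      \<Union> {{z \<in> fst c. snd c z \<in> W} |c W. c \<in> tangent_atlas A \<and> open W}"
    using topspace_tangent_topology[OF M]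
    unfolding tangent_topology_def topology_generated_by_topspace by auto
qed

text \<open>Taking coordinates in one chart is a continuous injection of the fibre into a Euclidean
  space, and the Hausdorff property pulls back along it.\<close>

lemma Hausdorff_tangent_space:
  assumes M: "smooth_manifold M A" and c: "c \<in> A" "q \<in> fst c"
  shows "Hausdorff_space (subtopology (tangent_topology A) ({q} \<times> tangent_space A q))"
    (is "Hausdorff_space ?T")
proof (rule Hausdorff_space_injective_preimage)
  have top: "topspace ?T \<subseteq> {q} \<times> tangent_space A q" by simp
  show "inj_on (\<lambda>z. snd z c) (topspace ?T)"
    using tangent_space_eqI[OF _ _ c] by (auto intro!: inj_onI)
  show "continuous_map ?T euclidean (\<lambda>z. snd z c)"
    unfolding continuous_map
  proof (intro conjI allI impI)
    fix W :: "'b set"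
    assume "openin euclidean W"
    \<comment> \<open>The set \<open>UNIV \<times> W\<close> constrains only the vector coordinate,
      so the preimage of \<open>W\<close> is the trace on the fibre of a generating open
      set.\<close>
    then have W: "open (UNIV \<times> W :: ('b \<times> 'b) set)" by (simp add: open_Times)
    have "openin (tangent_topology A) {z \<in> fst (tangent_chart A c). snd (tangent_chart A c) z \<in> UNIV \<times> W}"
      unfolding tangent_topology_def
    proof (rule topology_generated_by_Basis)
      have "tangent_chart A c \<in> tangent_atlas A"
        using c by (simp add: tangent_atlas_def)
      with W show "{z \<in> fst (tangent_chart A c). snd (tangent_chart A c) z \<in> UNIV \<times> W} \<in>
          {{z \<in> fst c. snd c z \<in> W} |c W. c \<in> tangent_atlas A \<and> open W}"
        by blast
    qed
    moreover have "{z \<in> topspace ?T. snd z c \<in> W} =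
        {z \<in> fst (tangent_chart A c). snd (tangent_chart A c) z \<in> UNIV \<times> W} \<inter> ({q} \<times> tangent_space A q)"
      using c smooth_manifold_chart(1)[OF M c(1)]
      by (auto simp: topspace_tangent_topology[OF M] tangent_chart_def tangent_bundle_def)
    ultimately show "openin ?T {z \<in> topspace ?T. snd z c \<in> W}"
      by (auto simp: openin_subtopology)
  qed simp
qed simp

section \<open>Local trivializations in natural coordinates\<close>

lemma local_trivialization_inverse:
  fixes A :: "('a, 'e::euclidean_space) chart set"
  assumes triv: "local_trivialization A U \<tau>" and "q \<in> U"
  shows "\<exists>v\<in>tangent_space A q.
    \<tau> (q, v) = (q, y) \<and> inv_into (tangent_bundle A U) \<tau> (q, y) = (q, v)"
proof -
  have bij: "bij_betw \<tau> (tangent_bundle A U) (U \<times> UNIV)"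
    using triv by (simp add: local_trivialization_def diffeomorphism_def)
  let ?z = "inv_into (tangent_bundle A U) \<tau> (q, y)"
  have z: "?z \<in> tangent_bundle A U" "\<tau> ?z = (q, y)"
    using bij \<open>q \<in> U\<close> by (auto simp: bij_betw_def intro: inv_into_into f_inv_into_f)
  then obtain p v where pv: "?z = (p, v)" "p \<in> U" "v \<in> tangent_space A p"
    by (auto simp: tangent_bundle_def)
  \<comment> \<open>Since \<open>\<tau>\<close> preserves base points, the preimage of
    \<open>(q, y)\<close> lies over \<open>q\<close>.\<close>
  then have "fst (\<tau> (p, v)) = p"
    using triv by (simp add: local_trivialization_def)
  with pv z have "p = q" by simp
  with pv z show ?thesis by auto
qed

lemma smooth_map_smooth_on:
  assumes "smooth_map A S B f" "c \<in> A" "d \<in> B"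
  shows "smooth_on (snd c ` {x \<in> S \<inter> fst c. f x \<in> fst d}) (snd d \<circ> f \<circ> inv_into (fst c) (snd c))"
  using assms unfolding smooth_map_def by blast

text \<open>\<open>H\<close> represents the inverse trivialization in the charts induced by
  \<open>(U, \<phi>)\<close>, and its second component is the map \<open>P\<close> of the overview.
  Of the smoothness contained in \<open>diffeomorphism\<close>, only the first order is
  extracted.\<close>

lemma local_trivialization_coordinates:
  fixes A :: "('a, 'e::euclidean_space) chart set"
  assumes M: "smooth_manifold M A" and c: "(U, \<phi>) \<in> A" and triv: "local_trivialization A U \<tau>"
  obtains H where
    "\<And>z. z \<in> \<phi> ` U \<times> UNIV \<Longrightarrow> H differentiable (at z)"
    "\<And>v. continuous_on (\<phi> ` U \<times> UNIV) (\<lambda>z. frechet_derivative H (at z) v)"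
    "\<And>q y. q \<in> U \<Longrightarrow>
      H (\<phi> q, y) = (\<phi> q, snd (inv_into (tangent_bundle A U) \<tau> (q, y)) (U, \<phi>))"
proof -
  define \<sigma> where "\<sigma> = inv_into (tangent_bundle A U) \<tau>"
  let ?c = "(U \<times> (UNIV :: 'e set), map_prod \<phi> (id :: 'e \<Rightarrow> 'e))"
  define H where "H = snd (tangent_chart A (U, \<phi>)) \<circ> \<sigma> \<circ> inv_into (fst ?c) (snd ?c)"
  have inj: "inj_on \<phi> U"
    using smooth_manifold_chart(2)[OF M c] by simp
  have "smooth_map (product_atlas A) (U \<times> UNIV) (tangent_atlas A) \<sigma>"
    using triv unfolding local_trivialization_def diffeomorphism_def \<sigma>_def by blast
  moreover have "?c \<in> product_atlas A"
    unfolding product_atlas_def by (rule image_eqI[OF _ c]) simp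
  moreover have "tangent_chart A (U, \<phi>) \<in> tangent_atlas A"
    using c by (simp add: tangent_atlas_def)
  ultimately have "smooth_on (snd ?c ` {z \<in> (U \<times> UNIV) \<inter> fst ?c. \<sigma> z \<in> fst (tangent_chart A (U, \<phi>))})
      (snd (tangent_chart A (U, \<phi>)) \<circ> \<sigma> \<circ> inv_into (fst ?c) (snd ?c))"
    by (rule smooth_map_smooth_on)
  then have "smooth_on (map_prod \<phi> id ` {z \<in> (U \<times> UNIV) \<inter> (U \<times> UNIV). \<sigma> z \<in> tangent_bundle A U}) H"
    by (simp add: H_def tangent_chart_def)
  moreover have "{z \<in> (U \<times> UNIV) \<inter> (U \<times> UNIV). \<sigma> z \<in> tangent_bundle A U} = U \<times> UNIV"
  proof -
    have "\<sigma> (q, y) \<in> tangent_bundle A U" if "q \<in> U" for q y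
      using local_trivialization_inverse[OF triv that, of y] that
      by (auto simp: \<sigma>_def tangent_bundle_def)
    then show ?thesis by auto
  qed
  ultimately have "Ck_on 1 (\<phi> ` U \<times> UNIV) H"
    by (simp add: smooth_on_def map_prod_surj_on[OF refl refl])
  then have H: "\<forall>z\<in>\<phi> ` U \<times> UNIV. H differentiable (at z)"
    "\<forall>v. continuous_on (\<phi> ` U \<times> UNIV) (\<lambda>z. frechet_derivative H (at z) v)"
    by simp_all
  have "H (\<phi> q, y) = (\<phi> q, snd (\<sigma> (q, y)) (U, \<phi>))" if "q \<in> U" for q y
  proof -
    have "inj_on (map_prod \<phi> (id :: 'e \<Rightarrow> 'e)) (U \<times> UNIV)"
      using inj by (intro map_prod_inj_on) auto
    then have "inv_into (U \<times> UNIV) (map_prod \<phi> id) (\<phi> q, y) = (q, y)"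
      using that inv_into_f_f[of "map_prod \<phi> id" "U \<times> UNIV" "(q, y)"] by simp
    moreover have "fst (\<sigma> (q, y)) = q"
      using local_trivialization_inverse[OF triv that, of y] by (auto simp: \<sigma>_def)
    ultimately show ?thesis
      by (simp add: H_def tangent_chart_def case_prod_beta)
  qed
  with H show thesis
    by (intro that[of H]) (auto simp: \<sigma>_def)
qed

section \<open>Construction of the unit vector fields and verification of the Pontryagin
  conditions\<close>

lemma Pontryagin_type_atI:
  fixes A :: "('a, real^'n) chart set"
  assumes M: "smooth_manifold M A" and c: "(U, \<phi>) \<in> A" and "p \<in> U"
    and triv: "local_trivialization A U \<tau>"
    and hor: "horizontally_C1 (\<phi> ` U)
      (F \<circ> inv_into (tangent_bundle A U) (map_prod \<phi> id \<circ> \<tau>))"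
  shows "Pontryagin_type_at A F p"
proof -
  define W where "W = \<phi> ` U"
  define G where "G = F \<circ> inv_into (tangent_bundle A U) (map_prod \<phi> id \<circ> \<tau>)"
  define \<sigma> where "\<sigma> = inv_into (tangent_bundle A U) \<tau>"
  define X where "X u q = snd (\<sigma> (q, inverse (G (\<phi> q, u)) *\<^sub>R u))" for u q
  define Y where "Y = (\<lambda>(x, u). X u (inv_into U \<phi> x) (U, \<phi>))"
  let ?S = "sphere 0 1 :: (real^'n) set"
  have hor': "horizontally_C1 W G" using hor by (simp add: G_def W_def)
  then have openW: "open W" by (simp add: horizontally_C1_def)
  have inj: "inj_on \<phi> U"
    using smooth_manifold_chart(2)[OF M c] by simp
  have bij: "bij_betw \<tau> (tangent_bundle A U) (U \<times> UNIV)"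
    using triv by (simp add: local_trivialization_def diffeomorphism_def)
  have G_norm: "asymmetric_norm_on UNIV (\<lambda>y. G (x, y))" if "x \<in> W" for x
    using hor' that unfolding horizontally_C1_def by blast
  have G_cont: "continuous_on (W \<times> UNIV) G"
    using hor' unfolding horizontally_C1_def by blast
  have "\<forall>i. \<exists>D. continuous_on (W \<times> UNIV) D \<and>
      (\<forall>x\<in>W. \<forall>y. has_partial_derivative (\<lambda>x'. G (x', y)) i (D (x, y)) x)"
    using hor' unfolding horizontally_C1_def by blast
  from choice[OF this] obtain DG where DG_cont: "\<And>i. continuous_on (W \<times> UNIV) (DG i)"
    and DG: "\<And>i x y. x \<in> W \<Longrightarrow> has_partial_derivative (\<lambda>x'. G (x', y)) i (DG i (x, y)) x"
    by blast
  have G_pos: "G (x, y) > 0" if "x \<in> W" "y \<noteq> 0" for x y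
    using G_norm[OF that(1)] that(2) unfolding asymmetric_norm_on_def
    by (metis UNIV_I order_le_less)
  have G_scale: "G (x, r *\<^sub>R y) = r * G (x, y)" if "x \<in> W" "r > 0" for x y r
    using G_norm[OF that(1)] that(2) unfolding asymmetric_norm_on_def by blast
  have \<sigma>: "\<exists>v\<in>tangent_space A q. \<tau> (q, v) = (q, y) \<and> \<sigma> (q, y) = (q, v)" if "q \<in> U" for q y
    using local_trivialization_inverse[OF triv that] unfolding \<sigma>_def .
  have \<sigma>_\<tau>: "\<sigma> (\<tau> (q, v)) = (q, v)" if "q \<in> U" "v \<in> tangent_space A q" for q v
    using bij that unfolding \<sigma>_def by (simp add: bij_betw_def tangent_bundle_def)
  \<comment> \<open>\<open>G\<close> is defined by inverting the composite with the chart, while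
    \<open>\<sigma>\<close> inverts \<open>\<tau>\<close> alone; injectivity of the composite on the
    bundle over \<open>U\<close> identifies the two.\<close>
  have FG: "F (\<sigma> (q, y)) = G (\<phi> q, y)" if q: "q \<in> U" for q y
  proof -
    obtain v where v: "v \<in> tangent_space A q" "\<tau> (q, v) = (q, y)" "\<sigma> (q, y) = (q, v)"
      using \<sigma>[OF q] by blast
    have "inj_on (map_prod \<phi> id \<circ> \<tau>) (tangent_bundle A U)"
      using bij map_prod_inj_on[OF inj inj_on_id[of UNIV]]
      by (intro comp_inj_on) (simp_all add: bij_betw_def)
    moreover have "(q, v) \<in> tangent_bundle A U" using v q by (simp add: tangent_bundle_def)
    ultimately have "inv_into (tangent_bundle A U) (map_prod \<phi> id \<circ> \<tau>) ((map_prod \<phi> id \<circ> \<tau>) (q, v)) = (q, v)"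
      by (rule inv_into_f_f)
    with v show ?thesis by (simp add: G_def)
  qed
  \<comment> \<open>Fibrewise homogeneity passes from \<open>\<tau>\<close> to its inverse.\<close>
  have \<sigma>_scale: "snd (\<sigma> (q, r *\<^sub>R y)) = r *\<^sub>R snd (\<sigma> (q, y))" if q: "q \<in> U" for q r y
  proof -
    obtain v where v: "v \<in> tangent_space A q" "\<tau> (q, v) = (q, y)" "\<sigma> (q, y) = (q, v)"
      using \<sigma>[OF q] by blast
    have rv: "r *\<^sub>R v \<in> tangent_space A q" using tangent_space_scaleR[OF M v(1)] .
    have "\<tau> (q, r *\<^sub>R v) = (q, r *\<^sub>R y)"
      using triv q v rv by (auto simp: local_trivialization_def prod_eq_iff)
    with \<sigma>_\<tau>[OF q rv] v show ?thesis by simp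
  qed
  have X_tangent: "X u q \<in> tangent_space A q" if "q \<in> U" for u q
    using \<sigma>[OF that, of "inverse (G (\<phi> q, u)) *\<^sub>R u"] by (auto simp: X_def)
  have X_pair: "(q, X u q) = \<sigma> (q, inverse (G (\<phi> q, u)) *\<^sub>R u)" if "q \<in> U" for u q
    using \<sigma>[OF that, of "inverse (G (\<phi> q, u)) *\<^sub>R u"] by (auto simp: X_def)
  have X_unit: "F (q, X u q) = 1" if "q \<in> U" "u \<in> ?S" for u q
  proof -
    have "\<phi> q \<in> W" "u \<noteq> 0" using that by (auto simp: W_def)
    then show ?thesis
      using G_pos[of "\<phi> q" u] by (simp add: X_pair FG G_scale that)
  qed

  obtain H where H_diff: "\<And>z. z \<in> W \<times> UNIV \<Longrightarrow> H differentiable (at z)"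
    and H_cont: "\<And>v. continuous_on (W \<times> UNIV) (\<lambda>z. frechet_derivative H (at z) v)"
    and H: "\<And>q y. q \<in> U \<Longrightarrow> H (\<phi> q, y) = (\<phi> q, snd (\<sigma> (q, y)) (U, \<phi>))"
    using local_trivialization_coordinates[OF M c triv] unfolding W_def \<sigma>_def by metis
  \<comment> \<open>Homogeneity pulls the normalizing scalar out of the trivialization, so the
    product rule in \<open>x\<close> applies with \<open>u\<close> held fixed in both
    factors.\<close>
  have Y_eq: "Y (x, u) = inverse (G (x, u)) *\<^sub>R snd (H (x, u))" if "x \<in> W" for x u
  proof -
    obtain q where q: "q \<in> U" "x = \<phi> q" using \<open>x \<in> W\<close> by (auto simp: W_def)
    then have "inv_into U \<phi> x = q" using inj by simp
    then show ?thesis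
      using q by (simp add: Y_def X_def H \<sigma>_scale scaleR_fun_def)
  qed
  have DH: "has_partial_derivative (\<lambda>x'. snd (H (x', u))) i
      (snd (frechet_derivative H (at (x, u)) (axis i 1, 0))) x" if "x \<in> W" for x u i
  proof (rule has_partial_derivative_Pair)
    have "(H has_derivative frechet_derivative H (at (x, u))) (at (x, u))"
      using H_diff that by (simp flip: frechet_derivative_works)
    then show "((\<lambda>z. snd (H z)) has_derivative (\<lambda>h. snd (frechet_derivative H (at (x, u)) h))) (at (x, u))"
      by (rule has_derivative_snd)
  qed
  \<comment> \<open>This is what the product rule and the rule for the inverse yield for the formula
    in \<open>Y_eq\<close>.\<close>
  define DY where "DY i z = inverse (G z) *\<^sub>R snd (frechet_derivative H (at z) (axis i 1, 0)) +
      (- (inverse (G z) * DG i z * inverse (G z))) *\<^sub>R snd (H z)" for i z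
  \<comment> \<open>The sphere avoids the zero vector, so \<open>inverse\<close> of \<open>G\<close>
    is continuous there.\<close>
  have G_nz: "\<forall>z\<in>W \<times> ?S. G z \<noteq> 0"
  proof
    fix z
    assume "z \<in> W \<times> ?S"
    then have "fst z \<in> W" "snd z \<noteq> 0" by auto
    from G_pos[OF this] show "G z \<noteq> 0" by simp
  qed
  have H_cont0: "continuous_on (W \<times> UNIV) H"
    using H_diff by (auto intro!: continuous_at_imp_continuous_on differentiable_imp_continuous_within)
  have sub: "W \<times> ?S \<subseteq> W \<times> UNIV" by auto
  note conts = continuous_on_subset[OF G_cont sub] continuous_on_subset[OF DG_cont sub]
    continuous_on_subset[OF H_cont sub] continuous_on_subset[OF H_cont0 sub]
  have Y_cont: "continuous_on (W \<times> ?S) Y"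
  proof (rule continuous_on_eq)
    show "continuous_on (W \<times> ?S) (\<lambda>z. inverse (G z) *\<^sub>R snd (H z))"
      using G_nz by (intro continuous_intros conts)
  qed (auto simp: Y_eq)
  have DY_cont: "continuous_on (W \<times> ?S) (DY i)" for i
    unfolding DY_def using G_nz by (intro continuous_intros conts)
  have DY: "has_partial_derivative (\<lambda>x'. Y (x', u)) i (DY i (x, u)) x" if "x \<in> W" "u \<in> ?S" for i x u
  \<comment> \<open>The formula for \<open>Y\<close> is available only over \<open>W\<close>; as
    \<open>W\<close> is open and partial derivatives are local, this suffices.\<close>
  proof (rule has_partial_derivative_cong_open[OF _ openW \<open>x \<in> W\<close>])
    have "G (x, u) \<noteq> 0" using G_nz that by blast
    with DG[OF \<open>x \<in> W\<close>] DH[OF \<open>x \<in> W\<close>]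
    show "has_partial_derivative (\<lambda>x'. inverse (G (x', u)) *\<^sub>R snd (H (x', u))) i (DY i (x, u)) x"
      unfolding DY_def by (intro has_partial_derivative_scaleR has_partial_derivative_inverse)
  qed (simp add: Y_eq)
  \<comment> \<open>Freezing one variable in the joint continuity statements serves twice: in
    \<open>x\<close> for the class C^1 and in \<open>u\<close> for the homeomorphism.\<close>
  have slice: "continuous_on W (\<lambda>x. (x, u))" "continuous_on ?S (\<lambda>u. (x, u))" for u x :: "real^'n"
    by (intro continuous_intros)+
  have "Ck_on 1 W (\<lambda>x. Y (x, u))" if "u \<in> ?S" for u
  proof (rule Ck_on_1_continuous_partials[OF openW DY])
    show "continuous_on W (\<lambda>x. DY i (x, u))" for i
      using that by (intro continuous_on_compose2[OF DY_cont slice(1)]) auto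
  qed (use that in auto)
  moreover have "homeomorphic_map (top_of_set ?S)
      (subtopology (tangent_topology A) (unit_sphere A F q)) (\<lambda>u. (q, X u q))" if q: "q \<in> U" for q
  proof (rule continuous_imp_homeomorphic_map)
    have x: "\<phi> q \<in> W" using q by (simp add: W_def)
    have "inv_into U \<phi> (\<phi> q) = q" using inj q by simp
    then have "continuous_on ?S (\<lambda>u. X u q (U, \<phi>))"
      using continuous_on_compose2[OF Y_cont slice(2)[of "\<phi> q"]] x by (auto simp: Y_def)
    then have "continuous_map (top_of_set ?S) (tangent_topology A) (\<lambda>u. (q, X u q))"
      using q X_tangent c by (intro continuous_map_into_tangent_space[OF M c]) auto
    moreover have into: "(q, X u q) \<in> unit_sphere A F q" if "u \<in> ?S" for u
      using X_tangent[OF q] X_unit[OF q that] by (simp add: unit_sphere_def)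
    ultimately show "continuous_map (top_of_set ?S)
        (subtopology (tangent_topology A) (unit_sphere A F q)) (\<lambda>u. (q, X u q))"
      by (auto simp: continuous_map_in_subtopology)
    show "compact_space (top_of_set ?S)" by (simp add: compact_space_subtopology)
    have fibre: "unit_sphere A F q \<subseteq> {q} \<times> tangent_space A q" by (auto simp: unit_sphere_def)
    have "Hausdorff_space (subtopology (tangent_topology A) ({q} \<times> tangent_space A q))"
      using q by (intro Hausdorff_tangent_space[OF M c]) simp
    from Hausdorff_space_subtopology[OF this, of "unit_sphere A F q"] fibre
    show "Hausdorff_space (subtopology (tangent_topology A) (unit_sphere A F q))"
      by (simp add: subtopology_subtopology Int_absorb1)
    show "inj_on (\<lambda>u. (q, X u q)) (topspace (top_of_set ?S))"
    proof (rule inj_onI)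
      fix u w
      assume uw: "u \<in> topspace (top_of_set ?S)" "w \<in> topspace (top_of_set ?S)" "(q, X u q) = (q, X w q)"
      have pos: "inverse (G (\<phi> q, u)) > 0" "inverse (G (\<phi> q, w)) > 0"
        using uw by (auto intro!: G_pos[OF x])
      \<comment> \<open>Applying \<open>\<tau>\<close> to both values of \<open>\<sigma>\<close>
        recovers the rescaled vectors. Then \<open>sgn\<close> removes the positive factors and
        fixes every unit vector.\<close>
      have "inverse (G (\<phi> q, u)) *\<^sub>R u = inverse (G (\<phi> q, w)) *\<^sub>R w"
        using uw(3) \<sigma>[OF q] unfolding X_pair[OF q] by (metis snd_conv)
      then have eq: "sgn (inverse (G (\<phi> q, u)) *\<^sub>R u) = sgn (inverse (G (\<phi> q, w)) *\<^sub>R w)" by simp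
      have "sgn u = sgn w" using eq pos by (simp add: sgn_scaleR)
      then show "u = w" using uw by (simp add: sgn_div_norm)
    qed
    have "z \<in> (\<lambda>u. (q, X u q)) ` ?S" if z: "z \<in> unit_sphere A F q" for z
    proof -
      obtain v where v: "z = (q, v)" "v \<in> tangent_space A q" "F (q, v) = 1"
        using z by (auto simp: unit_sphere_def)
      \<comment> \<open>Surjectivity: the witness is \<open>sgn y\<close>. Since
        \<open>G (\<phi> q, y) = 1\<close>, its norm under \<open>G\<close> is
        \<open>inverse (norm y)\<close>, so normalizing it gives back \<open>y\<close> and hence
        \<open>v\<close>.\<close>
      define y where "y = snd (\<tau> (q, v))"
      have "fst (\<tau> (q, v)) = q" using triv q v by (simp add: local_trivialization_def)
      then have "\<sigma> (q, y) = (q, v)" using \<sigma>_\<tau>[OF q v(2)] by (metis y_def prod.collapse)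
      with FG[OF q, of y] v have Gy: "G (\<phi> q, y) = 1" by simp
      have "G (\<phi> q, 0) = 0" using G_norm[OF x] unfolding asymmetric_norm_on_def by blast
      with Gy have "y \<noteq> 0" by auto
      then have "G (\<phi> q, sgn y) = inverse (norm y)"
        using G_scale[OF x, of "inverse (norm y)" y] Gy by (simp add: sgn_div_norm)
      then have "(q, X (sgn y) q) = (q, v)"
        using \<open>\<sigma> (q, y) = (q, v)\<close> \<open>y \<noteq> 0\<close> by (simp only: X_pair[OF q]) (simp add: sgn_div_norm)
      moreover have "sgn y \<in> ?S" using \<open>y \<noteq> 0\<close> by (simp add: norm_sgn)
      ultimately show ?thesis using v(1) by (metis imageI)
    qed
    moreover have "topspace (subtopology (tangent_topology A) (unit_sphere A F q)) = unit_sphere A F q"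
      using q smooth_manifold_chart(1)[OF M c]
      by (auto simp: topspace_tangent_topology[OF M] unit_sphere_def tangent_bundle_def)
    ultimately show "(\<lambda>u. (q, X u q)) ` topspace (top_of_set ?S) =
        topspace (subtopology (tangent_topology A) (unit_sphere A F q))"
      using into by auto
  qed
  ultimately have "let Y = (\<lambda>(x, u). X u (inv_into U \<phi> x) (U, \<phi>)) in
        (\<forall>u\<in>?S.
           (\<forall>q\<in>U. X u q \<in> tangent_space A q \<and> F (q, X u q) = 1) \<and>
           Ck_on 1 (\<phi> ` U) (\<lambda>x. Y (x, u))) \<and>
        (\<forall>q\<in>U. homeomorphic_map (top_of_set ?S)
           (subtopology (tangent_topology A) (unit_sphere A F q)) (\<lambda>u. (q, X u q))) \<and>
        continuous_on (\<phi> ` U \<times> ?S) Y \<and>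
        (\<forall>i. \<exists>D. continuous_on (\<phi> ` U \<times> ?S) D \<and>
           (\<forall>x\<in>\<phi> ` U. \<forall>u\<in>?S.
              has_partial_derivative (\<lambda>x'. Y (x', u)) i (D (x, u)) x))"
    unfolding Let_def Y_def[symmetric] W_def[symmetric]
    using X_tangent X_unit Y_cont DY_cont DY by blast
  with c \<open>p \<in> U\<close> show ?thesis
    unfolding Pontryagin_type_at_def by blast
qed

theorem proposition7p1:
  fixes M :: "'a topology"
    and A :: "('a, real^'n) chart set"
    and F :: "'a \<times> ('a, real^'n) tangent_vector \<Rightarrow> real"
  assumes "smooth_manifold M A"
    and "C0_Finsler M A F"
    and "\<forall>p\<in>topspace M. \<exists>U \<phi> \<tau>.
           (U, \<phi>) \<in> A \<and> p \<in> U \<and> local_trivialization A U \<tau> \<and>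
           horizontally_C1 (\<phi> ` U)
             (F \<circ> inv_into (tangent_bundle A U) (map_prod \<phi> id \<circ> \<tau>))"
  shows "Pontryagin_type M A F"
  unfolding Pontryagin_type_def
proof
  fix p
  assume "p \<in> topspace M"
  \<comment> \<open>The chart underlying the given trivialization also serves as the coordinate
    system of the Pontryagin condition.\<close>
  from bspec[OF assms(3) this] obtain U \<phi> \<tau> where "(U, \<phi>) \<in> A" "p \<in> U" "local_trivialization A U \<tau>"
    "horizontally_C1 (\<phi> ` U) (F \<circ> inv_into (tangent_bundle A U) (map_prod \<phi> id \<circ> \<tau>))"
    by (elim exE conjE) (rule that)
  then show "Pontryagin_type_at A F p"
    by (rule Pontryagin_type_atI[OF assms(1)])
qed

end
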